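(* For any $\epsilon>0$, any algorithm with constant error probability that returns a $(\frac{5}{3}-\epsilon)$-approximation of $\alpha(G)$ for a unit interval intersection graph $G$ on $n$ vertices given as an explicit vertex stream requires $\Omega(n)$ space.
   Context: A unit interval intersection graph has one vertex per closed interval of length $1$ in $\mathbb{R}$, with two vertices adjacent iff their intervals intersect. In an explicit vertex stream, the vertices of $G$ arrive one at a time in arbitrary order, each together with the list of all its edges to previously arrived vertices (no geometric representation is given); the stream is read once. $\alpha(G)$ is the maximum size of an independent set of $G$; a $c$-approximation of $\alpha(G)$ is a value $\gamma$ with $\frac{1}{c}\alpha(G)\le\gamma\le\alpha(G)$. *)

theory Defs
  imports
    "HOL-Probability.Probability"
    "HOL-Library.Ramsey"
    "HOL-Library.Landau_Symbols"
begin

text \<open>A simple graph is a vertex set together with a set of two-element edges; \<^const>\<open>indep\<close> is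
  the library's notion of an independent set.  The unit interval of vertex \<open>v\<close> is \<open>[l v, l v + 1]\<close>.\<close>

definition unit_interval_graph :: "'v set \<Rightarrow> 'v set set \<Rightarrow> bool" where
  "unit_interval_graph V E \<longleftrightarrow>
     (\<exists>l :: 'v \<Rightarrow> real.
        E = {{u, v} | u v. u \<in> V \<and> v \<in> V \<and> u \<noteq> v \<and> {l u..l u + 1} \<inter> {l v..l v + 1} \<noteq> {}})"

definition independence_number :: "'v set \<Rightarrow> 'v set set \<Rightarrow> nat" where
  "independence_number V E = Max (card ` {S. S \<subseteq> V \<and> indep S E})"

text \<open>The conjunct \<open>0 < c\<close> excludes the degenerate factors for which \<open>1 / c\<close> is not meaningful.\<close>

definition is_approximation :: "real \<Rightarrow> real \<Rightarrow> real \<Rightarrow> bool" where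
  "is_approximation c a \<gamma> \<longleftrightarrow> 0 < c \<and> 1 / c * a \<le> \<gamma> \<and> \<gamma> \<le> a"

type_synonym item = "nat \<times> nat set"

definition explicit_vertex_stream :: "nat set set \<Rightarrow> nat list \<Rightarrow> item list" where
  "explicit_vertex_stream E vs =
     map (\<lambda>k. (vs ! k, {u \<in> set (take k vs). {u, vs ! k} \<in> E})) [0..<length vs]"

definition unit_interval_streams :: "nat \<Rightarrow> (nat set set \<times> nat list) set" where
  "unit_interval_streams n =
     {(E, vs). unit_interval_graph {..<n} E \<and> distinct vs \<and> set vs = {..<n}}"

text \<open>A randomised one-pass algorithm.  The memory content is a bit string.  The outcome \<open>\<omega>\<close> of the coin
  tosses may be consulted at every step and is not charged to the memory; since the vertex names in a
  stream are distinct, this includes algorithms that toss fresh coins at every arrival.  No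
  computability or time restriction is imposed on the transitions.\<close>

record 'r stream_algorithm =
  coins :: "'r measure"
  initial :: "'r \<Rightarrow> bool list"
  update :: "'r \<Rightarrow> item \<Rightarrow> bool list \<Rightarrow> bool list"
  result :: "'r \<Rightarrow> bool list \<Rightarrow> real"

definition memory_after :: "'r stream_algorithm \<Rightarrow> 'r \<Rightarrow> item list \<Rightarrow> bool list" where
  "memory_after A \<omega> xs = fold (update A \<omega>) xs (initial A \<omega>)"

definition answer :: "'r stream_algorithm \<Rightarrow> item list \<Rightarrow> 'r \<Rightarrow> real" where
  "answer A xs \<omega> = result A \<omega> (memory_after A \<omega> xs)"

definition uses_space :: "'r stream_algorithm \<Rightarrow> nat \<Rightarrow> nat \<Rightarrow> bool" where
  "uses_space A n s \<longleftrightarrow>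
     (\<forall>(E, vs) \<in> unit_interval_streams n. \<forall>\<omega> \<in> space (coins A). \<forall>k \<le> n.
        length (memory_after A \<omega> (take k (explicit_vertex_stream E vs))) \<le> s)"

definition approximates_independence_number ::
    "'r stream_algorithm \<Rightarrow> nat \<Rightarrow> real \<Rightarrow> real \<Rightarrow> bool" where
  "approximates_independence_number A n c \<delta> \<longleftrightarrow>
     prob_space (coins A) \<and>
     (\<forall>(E, vs) \<in> unit_interval_streams n.
        answer A (explicit_vertex_stream E vs) \<in> borel_measurable (coins A) \<and>
        measure (coins A)
          {\<omega> \<in> space (coins A).
             \<not> is_approximation c (independence_number {..<n} E)
                 (answer A (explicit_vertex_stream E vs) \<omega>)} \<le> \<delta>)"

end

theory Submission
  imports Defs
begin

text \<open>Reduction from the one-way communication problem INDEX.  A set \<open>X \<subseteq> {..<m}\<close> is streamed as three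
  disjoint cliques: for \<open>j \<in> X\<close> the vertices \<open>u\<^sub>j\<close>, \<open>w\<^sub>j\<close> join a fixed vertex \<open>v\<close> in the middle clique,
  for \<open>j \<notin> X\<close> the vertex \<open>u\<^sub>j\<close> lies in a left and \<open>w\<^sub>j\<close> in a right clique.  To query \<open>i\<close>, two more
  vertices arrive: \<open>L\<close> adjacent to all \<open>u\<^sub>j\<close> with \<open>j \<noteq> i\<close>, and \<open>R\<close> adjacent to all \<open>w\<^sub>j\<close> with \<open>j \<noteq> i\<close>.
  The result is a unit interval graph.  If \<open>i \<notin> X\<close>, then \<open>u\<^sub>i, L, v, R, w\<^sub>i\<close> are independent; if
  \<open>i \<in> X\<close>, the left clique with \<open>L\<close>, the middle clique, and the right clique with \<open>R\<close> cover the graph.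
  So an approximation of the independence number with factor below \<open>5/3\<close> decides \<open>i \<in> X\<close>.
  INDEX needs linear communication: each decoded set \<open>Y\<close> contributes
  \<open>\<Sum>X. exp (- t * d(X, Y)) = (1 + exp (- t)) ^ m\<close>, where \<open>d\<close> is the Hamming distance, whereas an average
  distance of at most \<open>\<delta> m\<close> forces \<open>\<Sum>X. exp (- t * d(X, Y\<^sub>X)) \<ge> (2 * exp (- t * \<delta>)) ^ m\<close>.\<close>

section \<open>INDEX\<close>

text \<open>Symmetric difference with \<open>Y\<close> is an involution on \<open>Pow S\<close>, so
  the sum does not depend on \<open>Y\<close>; for \<open>Y = {}\<close> it is an expanded
  product.\<close>

lemma sum_Pow_power_card_sym_diff:
  fixes z :: real
  assumes "finite S" and "Y \<subseteq> S"
  shows "(\<Sum>X\<in>Pow S. z ^ card (sym_diff X Y)) = (1 + z) ^ card S"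
proof -
  have "(\<Sum>X\<in>Pow S. z ^ card (sym_diff X Y)) = (\<Sum>X\<in>Pow S. z ^ card X)"
    by (rule sum.reindex_bij_witness[where i = "\<lambda>X. sym_diff X Y" and j = "\<lambda>X. sym_diff X Y"])
       (use assms in auto)
  also have "\<dots> = (\<Prod>x\<in>S. z + 1)"
    using assms(1) by (subst prod_add) auto
  finally show ?thesis by (simp add: add.commute)
qed

lemma index_lower_bound:
  fixes enc :: "'r \<Rightarrow> nat set \<Rightarrow> 'm" and dec :: "'r \<Rightarrow> 'm \<Rightarrow> nat \<Rightarrow> bool" and \<delta> t :: real
  assumes "prob_space M" and "finite S" and "t > 0"
    and enc: "\<And>\<omega> X. \<omega> \<in> space M \<Longrightarrow> X \<subseteq> {..<m} \<Longrightarrow> enc \<omega> X \<in> S"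
    and meas: "\<And>X i. X \<subseteq> {..<m} \<Longrightarrow> i < m \<Longrightarrow>
        {\<omega> \<in> space M. dec \<omega> (enc \<omega> X) i \<noteq> (i \<in> X)} \<in> sets M"
    and err: "\<And>X i. X \<subseteq> {..<m} \<Longrightarrow> i < m \<Longrightarrow>
        measure M {\<omega> \<in> space M. dec \<omega> (enc \<omega> X) i \<noteq> (i \<in> X)} \<le> \<delta>"
  shows "(2 * exp (- t * \<delta>)) ^ m \<le> card S * (1 + exp (- t)) ^ m"
proof -
  interpret prob_space M by fact
  define P where "P = Pow {..<m}"
  define W where "W X i = {\<omega> \<in> space M. dec \<omega> (enc \<omega> X) i \<noteq> (i \<in> X)}" for X i
  define d where "d \<omega> X = (\<Sum>i<m. indicator (W X i) \<omega> :: real)" for \<omega> X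
  define Y where "Y \<omega> \<sigma> = {i. i < m \<and> dec \<omega> \<sigma> i}" for \<omega> \<sigma>
  define D where "D = \<delta> * m"
  define K where "K = card S * (1 + exp (- t)) ^ m"
  have finP: "finite P" and cardP: "card P = 2 ^ m"
    by (auto simp: P_def card_Pow)
  have d_eq: "d \<omega> X = card (sym_diff X (Y \<omega> (enc \<omega> X)))" if "\<omega> \<in> space M" "X \<in> P" for \<omega> X
  proof -
    have "d \<omega> X = (\<Sum>i<m. if dec \<omega> (enc \<omega> X) i \<noteq> (i \<in> X) then 1 else 0)"
      unfolding d_def using that by (intro sum.cong) (auto simp: W_def)
    also have "\<dots> = card {i \<in> {..<m}. dec \<omega> (enc \<omega> X) i \<noteq> (i \<in> X)}"
      by (subst sum.inter_filter[symmetric]) auto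
    also have "{i \<in> {..<m}. dec \<omega> (enc \<omega> X) i \<noteq> (i \<in> X)} = sym_diff X (Y \<omega> (enc \<omega> X))"
      using that by (auto simp: P_def Y_def)
    finally show ?thesis .
  qed
  have upper: "(\<Sum>X\<in>P. exp (- t * d \<omega> X)) \<le> K" if \<omega>: "\<omega> \<in> space M" for \<omega>
  proof -
    have "(\<Sum>X\<in>P. exp (- t * d \<omega> X)) = (\<Sum>X\<in>P. exp (- t) ^ card (sym_diff X (Y \<omega> (enc \<omega> X))))"
      by (intro sum.cong) (auto simp: d_eq[OF \<omega>] exp_of_nat_mult[symmetric] mult.commute)
    \<comment> \<open>Summing over all messages instead of the one sent decouples the decoded set
      from \<open>X\<close>, so the sums can be swapped.\<close>
    also have "\<dots> \<le> (\<Sum>X\<in>P. \<Sum>\<sigma>\<in>S. exp (- t) ^ card (sym_diff X (Y \<omega> \<sigma>)))"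
      using enc[OF \<omega>] \<open>finite S\<close>
      by (intro sum_mono member_le_sum[where f = "\<lambda>\<sigma>. exp (- t) ^ card (sym_diff _ (Y \<omega> \<sigma>))"])
         (auto simp: P_def)
    also have "\<dots> = (\<Sum>\<sigma>\<in>S. \<Sum>X\<in>P. exp (- t) ^ card (sym_diff X (Y \<omega> \<sigma>)))"
      by (rule sum.swap)
    also have "\<dots> = (\<Sum>\<sigma>\<in>S. (1 + exp (- t)) ^ m)"
      unfolding P_def by (intro sum.cong refl, subst sum_Pow_power_card_sym_diff) (auto simp: Y_def)
    finally show ?thesis by (simp add: K_def)
  qed
  \<comment> \<open>The tangent to the convex function \<open>exp (- t * x)\<close> at
    \<open>x = D\<close>. Being linear in \<open>x\<close>, it turns the bound on the expected
    distance into one on exponentials.\<close>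
  have tangent: "exp (- t * D) * (1 + t * D - t * x) \<le> exp (- t * x)" for x
  proof -
    have "1 + (t * D - t * x) \<le> exp (t * D - t * x)" by (rule exp_ge_add_one_self)
    then have "exp (- t * D) * (1 + (t * D - t * x)) \<le> exp (- t * D) * exp (t * D - t * x)"
      by (intro mult_left_mono) auto
    then show ?thesis by (simp add: exp_add[symmetric] algebra_simps)
  qed
  have int_d: "integrable M (\<lambda>\<omega>. d \<omega> X)" if "X \<in> P" for X
    unfolding d_def using that meas
    by (intro Bochner_Integration.integrable_sum) (auto simp: P_def W_def emeasure_eq_measure)
  have exp_d: "expectation (\<lambda>\<omega>. d \<omega> X) \<le> D" if "X \<in> P" for X
  proof -
    have "expectation (\<lambda>\<omega>. d \<omega> X) = (\<Sum>i<m. expectation (indicator (W X i)))"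
      unfolding d_def using that meas
      by (intro Bochner_Integration.integral_sum) (auto simp: P_def W_def emeasure_eq_measure)
    also have "\<dots> = (\<Sum>i<m. measure M (W X i))"
      by (intro sum.cong) (auto simp: W_def intro!: arg_cong[where f = prob])
    also have "\<dots> \<le> (\<Sum>i<m. \<delta>)"
      using that err by (intro sum_mono) (auto simp: P_def W_def)
    finally show ?thesis by (simp add: D_def mult.commute)
  qed
  define g where "g \<omega> = (\<Sum>X\<in>P. exp (- t * D) * (1 + t * D - t * d \<omega> X))" for \<omega>
  have "(2 * exp (- t * \<delta>)) ^ m = 2 ^ m * exp (- t * D)"
    by (simp add: power_mult_distrib exp_of_nat_mult[symmetric] D_def algebra_simps)
  also have "\<dots> = (\<Sum>X\<in>P. exp (- t * D) * (1 + t * D - t * D))"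
    by (simp add: cardP)
  also have "\<dots> \<le> (\<Sum>X\<in>P. exp (- t * D) * (1 + t * D - t * expectation (\<lambda>\<omega>. d \<omega> X)))"
    using exp_d \<open>t > 0\<close> by (intro sum_mono mult_left_mono diff_left_mono) auto
  also have "\<dots> = expectation g"
    unfolding g_def using int_d by (subst Bochner_Integration.integral_sum) (auto simp: prob_space)
  also have "\<dots> \<le> expectation (\<lambda>_. K)"
  proof (rule integral_mono)
    show "integrable M g"
      unfolding g_def using int_d by (intro Bochner_Integration.integrable_sum) auto
    show "g \<omega> \<le> K" if "\<omega> \<in> space M" for \<omega>
      unfolding g_def using sum_mono[OF tangent] upper[OF that] by (rule order_trans)
  qed simp
  finally show ?thesis by (simp add: K_def prob_space)
qed

text \<open>Both sides equal 2 at \<open>t = 0\<close>, where their difference has slope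
  \<open>1 - 2 * \<delta> > 0\<close>.\<close>

lemma exists_exponential_tilt:
  fixes \<delta> :: real
  assumes "\<delta> < 1 / 2"
  obtains t where "t > 0" and "2 * exp (- t * \<delta>) > 1 + exp (- t)"
proof -
  define f where "f t = 2 * exp (- t * \<delta>) - 1 - exp (- t)" for t
  have "(f has_real_derivative (1 - 2 * \<delta>)) (at 0)"
    unfolding f_def by (auto intro!: derivative_eq_intros)
  from DERIV_pos_inc_right[OF this] assms obtain e
    where e: "e > 0" "\<And>h. 0 < h \<Longrightarrow> h < e \<Longrightarrow> f 0 < f h"
    by auto
  have "f 0 < f (e / 2)" using e by simp
  then show ?thesis using e(1) that[of "e / 2"] by (simp add: f_def)
qed

lemma finite_bool_lists_length_le: "finite {bs :: bool list. length bs \<le> s}"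
  using finite_lists_length_le[of "UNIV :: bool set" s] by simp

lemma card_bool_lists_length_le: "card {bs :: bool list. length bs \<le> s} \<le> 2 ^ (s + 1)"
proof -
  have "card {bs :: bool list. length bs \<le> s} = (\<Sum>i\<le>s. 2 ^ i)"
    using card_lists_length_le[of "UNIV :: bool set" s] by simp
  also have "\<dots> \<le> 2 ^ (s + 1)"
    by (induction s) auto
  finally show ?thesis .
qed

section \<open>Unit interval graphs\<close>

definition unit_interval_edges :: "'v set \<Rightarrow> ('v \<Rightarrow> real) \<Rightarrow> 'v set set" where
  "unit_interval_edges V l =
     {{u, v} | u v. u \<in> V \<and> v \<in> V \<and> u \<noteq> v \<and> {l u..l u + 1} \<inter> {l v..l v + 1} \<noteq> {}}"

lemma unit_interval_graph_edges: "unit_interval_graph V (unit_interval_edges V l)"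
  by (auto simp: unit_interval_graph_def unit_interval_edges_def)

lemma unit_intervals_intersect_iff:
  "{a..a + 1} \<inter> {b..b + 1} \<noteq> {} \<longleftrightarrow> \<bar>a - b\<bar> \<le> (1 :: real)"
  by (auto simp: Int_atLeastAtMost)

lemma doubleton_in_unit_interval_edges:
  assumes "u \<in> V" and "v \<in> V" and "u \<noteq> v"
  shows "{u, v} \<in> unit_interval_edges V l \<longleftrightarrow> \<bar>l u - l v\<bar> \<le> 1"
  unfolding unit_interval_edges_def unit_intervals_intersect_iff
  using assms by (auto simp: doubleton_eq_iff abs_minus_commute)

lemma independence_number_le:
  assumes "finite V" and "\<And>S. S \<subseteq> V \<Longrightarrow> indep S E \<Longrightarrow> card S \<le> k"
  shows "independence_number V E \<le> k"
proof -
  have "{} \<in> {S. S \<subseteq> V \<and> indep S E}" by (simp add: indep_def)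
  moreover have "finite {S. S \<subseteq> V \<and> indep S E}" using assms(1) by simp
  ultimately show ?thesis
    unfolding independence_number_def using assms(2) by (subst Max_le_iff) auto
qed

lemma card_le_independence_number:
  assumes "finite V" and "S \<subseteq> V" and "indep S E"
  shows "card S \<le> independence_number V E"
  unfolding independence_number_def using assms by (intro Max_ge) auto

text \<open>The fibres of \<open>c\<close> are cliques, so \<open>c\<close> is injective on every
  independent set.\<close>

lemma independence_number_le_clique_cover:
  assumes "finite V" and "finite C" and "c ` V \<subseteq> C"
    and clique: "\<And>u v. u \<in> V \<Longrightarrow> v \<in> V \<Longrightarrow> u \<noteq> v \<Longrightarrow> c u = c v \<Longrightarrow> {u, v} \<in> E"
  shows "independence_number V E \<le> card C"
proof (rule independence_number_le)
  fix S assume "S \<subseteq> V" "indep S E"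
  then have "inj_on c S"
    using clique unfolding inj_on_def indep_def by (meson subsetD)
  then show "card S \<le> card C"
    using assms(2,3) \<open>S \<subseteq> V\<close> by (intro card_inj_on_le) auto
qed fact

section \<open>The hard instances\<close>

text \<open>The vertices are \<open>u\<^sub>j = j\<close> and \<open>w\<^sub>j = m + j\<close> for \<open>j < m\<close>, copies of \<open>v\<close> from \<open>2 * m\<close> to \<open>n - 3\<close>,
  \<open>L = n - 2\<close> and \<open>R = n - 1\<close>.\<close>

definition hard_pos :: "nat \<Rightarrow> nat \<Rightarrow> nat set \<Rightarrow> nat \<Rightarrow> nat \<Rightarrow> real" where
  "hard_pos n m X i v =
     (if v < m then
        (if v \<in> X then (if v = i then 0 else - 1 / 5) else (if v = i then - 11 / 5 else - 13 / 10))
      else if v < 2 * m then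
        (if v - m \<in> X then (if v - m = i then 0 else 1 / 5)
         else (if v - m = i then 11 / 5 else 13 / 10))
      else if v < n - 2 then 0
      else if v = n - 2 then - 11 / 10
      else 11 / 10)"

definition hard_edges :: "nat \<Rightarrow> nat \<Rightarrow> nat set \<Rightarrow> nat \<Rightarrow> nat set set" where
  "hard_edges n m X i = unit_interval_edges {..<n} (hard_pos n m X i)"

text \<open>The values -1, 0, 1 stand for the left, middle and right clique; copies of
  \<open>v\<close> get 0.\<close>

definition prefix_clique :: "nat \<Rightarrow> nat set \<Rightarrow> nat \<Rightarrow> int" where
  "prefix_clique m X v =
     (if v < m \<and> v \<notin> X then - 1 else if m \<le> v \<and> v < 2 * m \<and> v - m \<notin> X then 1 else 0)"

definition prefix_stream :: "nat \<Rightarrow> nat \<Rightarrow> nat set \<Rightarrow> item list" where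
  "prefix_stream n m X =
     map (\<lambda>k. (k, {u. u < k \<and> prefix_clique m X u = prefix_clique m X k})) [0..<n - 2]"

definition query_stream :: "nat \<Rightarrow> nat \<Rightarrow> nat \<Rightarrow> item list" where
  "query_stream n m i =
     [(n - 2, {u. u < m \<and> u \<noteq> i}), (n - 1, {u. m \<le> u \<and> u < 2 * m \<and> u \<noteq> m + i})]"

lemma hard_stream_in_unit_interval_streams:
  "(hard_edges n m X i, [0..<n]) \<in> unit_interval_streams n"
  by (auto simp: unit_interval_streams_def hard_edges_def unit_interval_graph_edges)

text \<open>The positions depend on both \<open>X\<close> and \<open>i\<close>, yet the stream
  splits into a part without \<open>i\<close> and a part without \<open>X\<close>. This makes the
  memory between them a one-way message about \<open>X\<close>.\<close>

lemma hard_stream_eq: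
  assumes "2 * m + 3 \<le> n"
  shows "explicit_vertex_stream (hard_edges n m X i) [0..<n] =
     prefix_stream n m X @ query_stream n m i"
proof -
  define E where "E = hard_edges n m X i"
  have adj: "{u, k} \<in> E \<longleftrightarrow> \<bar>hard_pos n m X i u - hard_pos n m X i k\<bar> \<le> 1" if "u < k" "k < n" for u k
    unfolding E_def hard_edges_def using that by (intro doubleton_in_unit_interval_edges) auto
  have range: "hard_pos n m X i v \<in> (if prefix_clique m X v = - 1 then {- 11 / 5, - 13 / 10}
      else if prefix_clique m X v = 0 then {- 1 / 5, 0, 1 / 5} else {13 / 10, 11 / 5})"
    and clique: "prefix_clique m X v \<in> {- 1, 0, 1}" if "v < n - 2" for v
    using that by (auto simp: hard_pos_def prefix_clique_def)
  \<comment> \<open>Positions within a clique differ by at most 9/10, those in different cliques by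
    at least 11/10, so the shift of \<open>u\<^sub>i\<close> and \<open>w\<^sub>i\<close> stays
    invisible.\<close>
  have "\<bar>hard_pos n m X i u - hard_pos n m X i k\<bar> \<le> 1 \<longleftrightarrow> prefix_clique m X u = prefix_clique m X k"
    if "u < n - 2" "k < n - 2" for u k
    using range[OF that(1)] range[OF that(2)] clique[OF that(1)] clique[OF that(2)]
    by (elim insertE emptyE) auto
  then have pre: "{u. u < k \<and> {u, k} \<in> E} = {u. u < k \<and> prefix_clique m X u = prefix_clique m X k}"
    if "k < n - 2" for k
    using that by (auto simp: adj)
  have "hard_pos n m X i (n - 2) = - 11 / 10"
    using assms by (simp add: hard_pos_def)
  \<comment> \<open>From \<open>L\<close> the positions -13/10 and -1/5 of the other
    \<open>u\<^sub>j\<close> are within 1, while both possible positions of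
    \<open>u\<^sub>i\<close>, -11/5 and 0, are at distance 11/10.\<close>
  moreover have "\<bar>hard_pos n m X i u - (- 11 / 10)\<bar> \<le> 1 \<longleftrightarrow> u < m \<and> u \<noteq> i" if "u < n - 2" for u
    using that by (simp add: hard_pos_def)
  ultimately have L: "{u. u < n - 2 \<and> {u, n - 2} \<in> E} = {u. u < m \<and> u \<noteq> i}"
    using assms by (auto simp: adj)
  have "\<not> n - 1 < 2 * m" "\<not> n - 1 < n - 2" "n - 1 \<noteq> n - 2"
    using assms by linarith+
  then have posR: "hard_pos n m X i (n - 1) = 11 / 10"
    unfolding hard_pos_def by simp
  have nearR: "\<bar>hard_pos n m X i u - 11 / 10\<bar> \<le> 1 \<longleftrightarrow> m \<le> u \<and> u < 2 * m \<and> u \<noteq> m + i"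
    if "u < n - 1" for u
  proof -
    have sub: "u - m = i \<longleftrightarrow> u = m + i" if "m \<le> u" using that by auto
    consider "u < m" | "m \<le> u" "u < 2 * m" | "2 * m \<le> u" "m \<le> u" "u < n - 2"
      | "2 * m \<le> u" "m \<le> u" "u = n - 2"
      using \<open>u < n - 1\<close> by linarith
    then show ?thesis by cases (use assms in \<open>simp_all add: hard_pos_def sub\<close>)
  qed
  have "n - 1 < n" using assms by simp
  have "{u, n - 1} \<in> E \<longleftrightarrow> m \<le> u \<and> u < 2 * m \<and> u \<noteq> m + i" if "u < n - 1" for u
    using nearR[OF that] unfolding adj[OF that \<open>n - 1 < n\<close>] posR .
  then have R: "{u. u < n - 1 \<and> {u, n - 1} \<in> E} = {u. m \<le> u \<and> u < 2 * m \<and> u \<noteq> m + i}"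
    using assms by auto
  have split: "[0..<n] = [0..<n - 2] @ [n - 2, n - 1]"
  proof -
    have "n = Suc (Suc (n - 2))" "n - 1 = Suc (n - 2)" using assms by auto
    then show ?thesis by (metis upt_Suc_append append_assoc append_Cons append_Nil le0)
  qed
  have "explicit_vertex_stream E [0..<n] = map (\<lambda>k. (k, {u. u < k \<and> {u, k} \<in> E})) [0..<n]"
    by (auto simp: explicit_vertex_stream_def)
  also have "\<dots> = prefix_stream n m X @ query_stream n m i"
    unfolding split using pre L R by (simp add: prefix_stream_def query_stream_def)
  finally show ?thesis by (simp add: E_def)
qed

text \<open>Since \<open>i \<in> X\<close>, the positions -11/5 and 11/5 do not occur; cutting the
  line at -1 and 1 leaves three groups of diameter at most 1.\<close>

lemma independence_number_hard_le:
  assumes "i \<in> X" and "2 * m + 3 \<le> n"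
  shows "independence_number {..<n} (hard_edges n m X i) \<le> 3"
proof -
  define l where "l = hard_pos n m X i"
  define c where "c v = (if l v < - 1 then 0 else if l v < 1 then 1 else 2 :: nat)" for v
  have "l v \<in> {- 13 / 10, - 11 / 10, - 1 / 5, 0, 1 / 5, 11 / 10, 13 / 10}" for v
    using assms by (auto simp: l_def hard_pos_def)
  note l = this[unfolded insert_iff empty_iff]
  have "\<bar>l u - l v\<bar> \<le> 1" if "c u = c v" for u v
    using l[of u] l[of v] that unfolding c_def by (elim disjE) simp_all
  then have "independence_number {..<n} (hard_edges n m X i) \<le> card {0, 1, 2 :: nat}"
    by (intro independence_number_le_clique_cover[where c = c])
       (auto simp: c_def hard_edges_def l_def doubleton_in_unit_interval_edges)
  then show ?thesis by simp
qed

text \<open>The five vertices of \<open>S\<close> sit at consecutive distances 11/10;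
  \<open>2 * m\<close> is the first copy of \<open>v\<close>.\<close>

lemma independence_number_hard_ge:
  assumes "i \<notin> X" and "i < m" and "2 * m + 3 \<le> n"
  shows "5 \<le> independence_number {..<n} (hard_edges n m X i)"
proof -
  define S where "S = {i, m + i, 2 * m, n - 2, n - 1}"
  have order: "\<not> n - 1 < 2 * m" "\<not> n - 1 < n - 2" "n - 1 \<noteq> n - 2"
    using assms by linarith+
  have pos: "hard_pos n m X i i = - 11 / 5" "hard_pos n m X i (m + i) = 11 / 5"
    "hard_pos n m X i (2 * m) = 0" "hard_pos n m X i (n - 2) = - 11 / 10"
    using assms by (simp_all add: hard_pos_def)
  have pos': "hard_pos n m X i (n - 1) = 11 / 10"
    using order unfolding hard_pos_def by simp
  have "S \<subseteq> {..<n}" using assms by (auto simp: S_def)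
  have far: "\<forall>u\<in>S. \<forall>v\<in>S. u \<noteq> v \<longrightarrow> \<bar>hard_pos n m X i u - hard_pos n m X i v\<bar> > 1"
    unfolding S_def by (simp add: pos pos' del: One_nat_def)
  have "indep S (hard_edges n m X i)"
    unfolding indep_def
  proof (intro ballI impI)
    fix u v assume uv: "u \<in> S" "v \<in> S" "u \<noteq> v"
    then have "\<bar>hard_pos n m X i u - hard_pos n m X i v\<bar> > 1"
      using far by blast
    then show "{u, v} \<notin> hard_edges n m X i"
      using uv \<open>S \<subseteq> {..<n}\<close> unfolding hard_edges_def
      by (subst doubleton_in_unit_interval_edges) auto
  qed
  then have "card S \<le> independence_number {..<n} (hard_edges n m X i)"
    using \<open>S \<subseteq> {..<n}\<close> by (intro card_le_independence_number) auto
  moreover have "card S = 5"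
  proof -
    have "2 * m \<noteq> n - 2" "2 * m \<noteq> n - 1" using assms by linarith+
    then show ?thesis unfolding S_def using assms order by (simp add: card_insert_if)
  qed
  ultimately show ?thesis by simp
qed

text \<open>The threshold 3 separates the cases: either \<open>\<gamma>\<close> is at most \<alpha>,
  hence at most 3, or \<open>\<gamma>\<close> is at least 5 divided by a factor below 5/3.\<close>

lemma is_approximation_hard_iff:
  assumes "i < m" and "2 * m + 3 \<le> n" and "\<epsilon> > 0"
    and "is_approximation (5 / 3 - \<epsilon>) (independence_number {..<n} (hard_edges n m X i)) \<gamma>"
  shows "\<gamma> \<le> 3 \<longleftrightarrow> i \<in> X"
proof (cases "i \<in> X")
  case True
  then show ?thesis
    using independence_number_hard_le[of i X m n] assms by (auto simp: is_approximation_def)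
next
  case False
  define c where "c = 5 / 3 - \<epsilon>"
  define a where "a = real (independence_number {..<n} (hard_edges n m X i))"
  have "0 < c" "c < 5 / 3" "a / c \<le> \<gamma>"
    using assms by (auto simp: is_approximation_def a_def c_def)
  moreover have "5 \<le> a"
    using independence_number_hard_ge[OF False assms(1,2)] by (simp add: a_def)
  ultimately have "3 < a / c" by (simp add: field_simps)
  then show ?thesis using False \<open>a / c \<le> \<gamma>\<close> by simp
qed

section \<open>Streaming algorithms as protocols for INDEX, and linear growth of the space\<close>

lemma streaming_space_lower_bound:
  fixes A :: "'r stream_algorithm" and \<epsilon> \<delta> t :: real
  assumes approx: "approximates_independence_number A n (5 / 3 - \<epsilon>) \<delta>"
    and space: "uses_space A n s"
    and "\<epsilon> > 0" and "t > 0" and n: "2 * m + 3 \<le> n"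
  shows "(2 * exp (- t * \<delta>)) ^ m \<le> 2 ^ (s + 1) * (1 + exp (- t)) ^ m"
proof -
  define M where "M = coins A"
  define enc where "enc \<omega> X = memory_after A \<omega> (prefix_stream n m X)" for \<omega> X
  define dec where
    "dec \<omega> \<sigma> i \<longleftrightarrow> result A \<omega> (fold (update A \<omega>) (query_stream n m i) \<sigma>) \<le> 3" for \<omega> \<sigma> i
  define ans where
    "ans X i = answer A (explicit_vertex_stream (hard_edges n m X i) [0..<n])" for X i
  have dec_enc: "dec \<omega> (enc \<omega> X) i \<longleftrightarrow> ans X i \<omega> \<le> 3" for \<omega> X i
    by (simp add: dec_def enc_def ans_def answer_def memory_after_def hard_stream_eq[OF n])
  interpret prob_space M
    using approx by (simp add: approximates_independence_number_def M_def)
  have ans_meas [measurable]: "ans X i \<in> borel_measurable M"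
    and ans_err: "prob {\<omega> \<in> space M. \<not> is_approximation (5 / 3 - \<epsilon>)
        (independence_number {..<n} (hard_edges n m X i)) (ans X i \<omega>)} \<le> \<delta>" for X i
    using approx hard_stream_in_unit_interval_streams[of n m X i]
    by (auto simp: approximates_independence_number_def M_def ans_def)
  have "(2 * exp (- t * \<delta>)) ^ m \<le> card {bs :: bool list. length bs \<le> s} * (1 + exp (- t)) ^ m"
  proof (rule index_lower_bound[where M = M and enc = enc and dec = dec])
    show "enc \<omega> X \<in> {bs. length bs \<le> s}" if "\<omega> \<in> space M" for \<omega> X
    proof -
      \<comment> \<open>\<open>uses_space\<close> speaks only of prefixes of complete streams; the
        query index 0 is an arbitrary completion.\<close>
      have "length (memory_after A \<omega>
          (take (n - 2) (explicit_vertex_stream (hard_edges n m X 0) [0..<n]))) \<le> s"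
        using space hard_stream_in_unit_interval_streams[of n m X 0] that
        unfolding uses_space_def M_def by fastforce
      moreover have "length (prefix_stream n m X) = n - 2"
        by (simp add: prefix_stream_def)
      ultimately show ?thesis
        by (simp add: hard_stream_eq[OF n] enc_def)
    qed
    fix X i assume "i < m"
    show "{\<omega> \<in> space M. dec \<omega> (enc \<omega> X) i \<noteq> (i \<in> X)} \<in> sets M"
      unfolding dec_enc by measurable
    have "prob {\<omega> \<in> space M. dec \<omega> (enc \<omega> X) i \<noteq> (i \<in> X)} \<le>
        prob {\<omega> \<in> space M. \<not> is_approximation (5 / 3 - \<epsilon>)
          (independence_number {..<n} (hard_edges n m X i)) (ans X i \<omega>)}"
    proof (rule finite_measure_mono)
      show "{\<omega> \<in> space M. dec \<omega> (enc \<omega> X) i \<noteq> (i \<in> X)} \<subseteq>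
          {\<omega> \<in> space M. \<not> is_approximation (5 / 3 - \<epsilon>)
            (independence_number {..<n} (hard_edges n m X i)) (ans X i \<omega>)}"
        unfolding dec_enc using is_approximation_hard_iff[OF \<open>i < m\<close> n \<open>\<epsilon> > 0\<close>] by blast
      show "{\<omega> \<in> space M. \<not> is_approximation (5 / 3 - \<epsilon>)
          (independence_number {..<n} (hard_edges n m X i)) (ans X i \<omega>)} \<in> events"
        unfolding is_approximation_def by measurable
    qed
    then show "prob {\<omega> \<in> space M. dec \<omega> (enc \<omega> X) i \<noteq> (i \<in> X)} \<le> \<delta>"
      using ans_err[of X i] by linarith
  qed (use \<open>t > 0\<close> finite_bool_lists_length_le in \<open>auto intro: prob_space_axioms\<close>)
  also have "\<dots> \<le> 2 ^ (s + 1) * (1 + exp (- t)) ^ m"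
  proof (rule mult_right_mono)
    have "real (card {bs :: bool list. length bs \<le> s}) \<le> real (2 ^ (s + 1))"
      using card_bool_lists_length_le by (rule of_nat_mono)
    then show "real (card {bs :: bool list. length bs \<le> s}) \<le> 2 ^ (s + 1)" by simp
  qed (simp add: add_nonneg_nonneg)
  finally show ?thesis .
qed

theorem theorem10:
  fixes \<epsilon> \<delta> :: real
    and A :: "nat \<Rightarrow> 'r stream_algorithm"
    and s :: "nat \<Rightarrow> nat"
  assumes "\<epsilon> > 0" and "\<delta> < 1 / 2"
    and "\<And>n. approximates_independence_number (A n) n (5 / 3 - \<epsilon>) \<delta>"
    and "\<And>n. uses_space (A n) n (s n)"
  shows "(\<lambda>n. real (s n)) \<in> \<Omega>(\<lambda>n. real n)"
proof -
  obtain t where t: "t > 0" "2 * exp (- t * \<delta>) > 1 + exp (- t)"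
    using exists_exponential_tilt[OF assms(2)] .
  define q where "q = 2 * exp (- t * \<delta>) / (1 + exp (- t))"
  have pos: "1 + exp (- t) > 0" by (simp add: add_pos_pos)
  then have "q > 1" using t(2) by (simp add: q_def)
  define b where "b = log 2 q"
  have "b > 0" using \<open>q > 1\<close> by (simp add: b_def)
  have bound: "real (s n) + 1 \<ge> ((real n - 4) / 2) * b" if "n \<ge> 4" for n
  proof -
    \<comment> \<open>The largest \<open>m\<close> with \<open>2 * m + 3 \<le> n\<close>; rounding
      costs at most one vertex, hence the 4 in the bound.\<close>
    define m where "m = (n - 3) div 2"
    have "q ^ m \<le> 2 ^ (s n + 1)"
      using streaming_space_lower_bound[OF assms(3,4,1) t(1), of m n] that pos
      by (simp add: m_def q_def power_divide pos_divide_le_eq)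
    then have "log 2 (q ^ m) \<le> log 2 (2 ^ (s n + 1))"
      using \<open>q > 1\<close> by (subst log_le_cancel_iff) auto
    then have "m * b \<le> real (s n + 1)"
      using \<open>q > 1\<close> by (simp add: log_nat_power b_def del: power_Suc)
    moreover have "n \<le> 2 * m + 4"
      using that by (simp add: m_def)
    then have "real n \<le> real (2 * m + 4)" by (rule of_nat_mono)
    then have "(real n - 4) / 2 \<le> real m" by simp
    then have "((real n - 4) / 2) * b \<le> m * b"
      using \<open>b > 0\<close> by (intro mult_right_mono) auto
    ultimately show ?thesis by simp
  qed
  have "eventually (\<lambda>n. b / 4 * norm (real n) \<le> norm (real (s n))) sequentially"
    \<comment> \<open>From here on \<open>(n - 4) / 2 * b - 1\<close> is at least
      \<open>b / 4 * n\<close>.\<close>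
    using eventually_ge_at_top[of "nat \<lceil>8 + 4 / b\<rceil>"]
  proof eventually_elim
    case (elim n)
    then have n: "real n \<ge> 8 + 4 / b" by linarith
    then have "real n \<ge> 4" using \<open>b > 0\<close> by (smt (verit) divide_pos_pos)
    then have "n \<ge> 4" by linarith
    have "real n * b \<ge> (8 + 4 / b) * b" using n \<open>b > 0\<close> by (intro mult_right_mono) auto
    then have "real n * b \<ge> 8 * b + 4" using \<open>b > 0\<close> by (simp add: distrib_right)
    then show ?case using bound[OF \<open>n \<ge> 4\<close>] by (simp add: field_simps)
  qed
  then show ?thesis
    using \<open>b > 0\<close> by (intro landau_omega.bigI[of "b / 4"]) auto
qed

end
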